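(* Let $X$ be a compact metric space and let $f: X \to X$ be a homeomorphism. Then there is a complete Lyapunov function $g: X \to \mathbb{R}$ for $f$.
   Context: Let $f: X\to X$ be a homeomorphism of a compact metric space $(X,d)$. For $\varepsilon>0$, an $\varepsilon$-chain from $x$ to $y$ for $f$ is a finite sequence of points $x=x_0,x_1,\dots,x_n=y$ in $X$, with $n\ge 1$, such that $d(f(x_i),x_{i+1})<\varepsilon$ for $0\le i\le n-1$. A point $x\in X$ is chain recurrent if for every $\varepsilon>0$ there is an $\varepsilon$-chain from $x$ to itself; $\mathcal{R}(f)$ denotes the set of chain recurrent points. For $x,y\in\mathcal{R}(f)$ write $x\sim y$ if for every $\varepsilon>0$ there is an $\varepsilon$-chain from $x$ to $y$ and another from $y$ to $x$; this is an equivalence relation on $\mathcal{R}(f)$, whose equivalence classes are called the chain transitive components of $\mathcal{R}(f)$. A complete Lyapunov function for $f$ is a continuous function $g: X\to\mathbb{R}$ satisfying: (1) if $x\notin\mathcal{R}(f)$, then $g(f(x))<g(x)$; (2) if $x,y\in\mathcal{R}(f)$, then $g(x)=g(y)$ if and only if $x\sim y$ (i.e. $x$ and $y$ are in the same chain transitive component); (3) $g(\mathcal{R}(f))$ is a compact nowhere dense subset of $\mathbb{R}$. *)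

theory Defs
  imports "HOL-Analysis.Analysis"
begin

text \<open>
  The space is a subset \<open>X\<close> of a type of class \<open>metric_space\<close>, with the induced metric; maps on
  the space are functions on the whole type of which only the values on \<open>X\<close> matter.
\<close>

definition eps_chain ::
  "'a::metric_space set \<Rightarrow> ('a \<Rightarrow> 'a) \<Rightarrow> real \<Rightarrow> 'a \<Rightarrow> 'a \<Rightarrow> nat \<Rightarrow> (nat \<Rightarrow> 'a) \<Rightarrow> bool" where
  "eps_chain X f \<epsilon> x y n p \<longleftrightarrow>
     n \<ge> 1 \<and> p 0 = x \<and> p n = y \<and> (\<forall>i\<le>n. p i \<in> X) \<and> (\<forall>i<n. dist (f (p i)) (p (Suc i)) < \<epsilon>)"

definition chain_recurrent_set :: "'a::metric_space set \<Rightarrow> ('a \<Rightarrow> 'a) \<Rightarrow> 'a set" where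
  "chain_recurrent_set X f = {x \<in> X. \<forall>\<epsilon>>0. \<exists>n p. eps_chain X f \<epsilon> x x n p}"

definition chain_equiv :: "'a::metric_space set \<Rightarrow> ('a \<Rightarrow> 'a) \<Rightarrow> 'a \<Rightarrow> 'a \<Rightarrow> bool" where
  "chain_equiv X f x y \<longleftrightarrow>
     (\<forall>\<epsilon>>0. (\<exists>n p. eps_chain X f \<epsilon> x y n p) \<and> (\<exists>n p. eps_chain X f \<epsilon> y x n p))"

definition nowhere_dense :: "'a::topological_space set \<Rightarrow> bool" where
  "nowhere_dense S \<longleftrightarrow> interior (closure S) = {}"

definition complete_lyapunov_function ::
  "'a::metric_space set \<Rightarrow> ('a \<Rightarrow> 'a) \<Rightarrow> ('a \<Rightarrow> real) \<Rightarrow> bool" where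
  "complete_lyapunov_function X f g \<longleftrightarrow>
     continuous_on X g \<and>
     (\<forall>x \<in> X - chain_recurrent_set X f. g (f x) < g x) \<and>
     (\<forall>x \<in> chain_recurrent_set X f. \<forall>y \<in> chain_recurrent_set X f.
        g x = g y \<longleftrightarrow> chain_equiv X f x y) \<and>
     compact (g ` chain_recurrent_set X f) \<and>
     nowhere_dense (g ` chain_recurrent_set X f)"

end

theory Submission
  imports Defs
begin

text \<open>
  The set \<open>U\<close> of points reachable from \<open>q\<close> by \<open>\<epsilon>\<close>-chains is open and satisfies
  \<open>f (closure U) \<subseteq> U\<close>. For any such \<open>U\<close>, every continuous \<open>u\<close> with values in \<open>[0,1]\<close>
  that vanishes on \<open>f (closure U)\<close> and equals 1 off \<open>U\<close> is nonincreasing along orbits, and it is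
  0 or 1 on the chain recurrent set, because chains of small jumps that start in \<open>closure U\<close>
  cannot leave a neighbourhood of \<open>f (closure U)\<close>. Letting \<open>q\<close> run through a countable dense set
  and \<open>\<epsilon>\<close> through a sequence tending to 0 gives functions \<open>u\<^sub>i\<close> that detect all points which are
  not chain recurrent and separate all chain transitive components. The sum of the \<open>u\<^sub>i / 3\<^sup>i\<close>
  is a complete Lyapunov function: on the chain recurrent set its values are ternary sums with
  digits 0 and 1, which lie in a Cantor set and determine their digits.
\<close>

section \<open>Ternary sums\<close>

definition ternary :: "(nat \<Rightarrow> real) \<Rightarrow> real" where
  "ternary a = (\<Sum>n. a n / 3 ^ n)"

lemma summable_third_powers: "summable (\<lambda>n. 1 / 3 ^ n :: real)"
  using summable_geometric[of "1/3::real"] by (simp add: power_one_over)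

lemma summable_ternary:
  fixes a :: "nat \<Rightarrow> real"
  assumes "\<And>n. a n \<in> {0..1}"
  shows "summable (\<lambda>n. a n / 3 ^ n)"
proof (rule summable_comparison_test'[OF summable_third_powers])
  show "norm (a n / 3 ^ n) \<le> 1 / 3 ^ n" if "n \<ge> 0" for n
    using assms[of n] by (simp add: divide_right_mono)
qed

lemma ternary_bounds:
  assumes "\<And>n. a n \<in> {0..1}"
  shows "ternary a \<in> {0..3/2}"
proof -
  have "ternary a \<le> (\<Sum>n. 1 / 3 ^ n)"
    unfolding ternary_def using assms
    by (intro suminf_le summable_ternary summable_third_powers) (auto simp: divide_right_mono)
  also have "\<dots> = 3/2"
    using suminf_geometric[of "1/3::real"] by (simp add: power_one_over)
  finally have "ternary a \<le> 3/2" .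
  moreover have "0 \<le> ternary a"
    unfolding ternary_def using assms by (intro suminf_nonneg summable_ternary) auto
  ultimately show ?thesis by simp
qed

lemma ternary_Suc:
  assumes "\<And>n. a n \<in> {0..1}"
  shows "ternary a = a 0 + ternary (\<lambda>n. a (Suc n)) / 3"
proof -
  have "(\<Sum>n. a (Suc n) / 3 ^ n / 3) = ternary (\<lambda>n. a (Suc n)) / 3"
    unfolding ternary_def using assms by (intro suminf_divide summable_ternary) auto
  moreover have "(\<Sum>n. a (Suc n) / 3 ^ Suc n) = ternary a - a 0"
    using suminf_split_head[OF summable_ternary[OF assms]] by (simp add: ternary_def)
  ultimately show ?thesis
    by (simp add: field_simps)
qed

text \<open>The tail after the leading digit contributes at most 1/2, so leading digits 0 and 1 give
  sums in the disjoint intervals [0,1/2] and [1,3/2]. The sum therefore fixes its leading digit and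
  the sum of the shifted sequence, and induction on the position finishes.\<close>

lemma ternary_inj:
  assumes "\<And>n. a n \<in> {0, 1}" "\<And>n. b n \<in> {0, 1}" "ternary a = ternary b"
  shows "a n = b n"
  using assms
proof (induction n arbitrary: a b)
  have *: "a 0 = b 0 \<and> ternary (\<lambda>n. a (Suc n)) = ternary (\<lambda>n. b (Suc n))"
    if "\<And>n. a n \<in> {0, 1}" "\<And>n. b n \<in> {0, 1}" "ternary a = ternary b" for a b
  proof -
    have a: "\<And>n. a n \<in> {0..1}" and b: "\<And>n. b n \<in> {0..1}"
      using that by (metis atLeastAtMost_iff insertE order_refl singletonD zero_le_one)+
    have "ternary (\<lambda>n. a (Suc n)) \<in> {0..3/2}" "ternary (\<lambda>n. b (Suc n)) \<in> {0..3/2}"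
      by (intro ternary_bounds a b)+
    with ternary_Suc[of a, OF a] ternary_Suc[of b, OF b] that(1)[of 0] that(2)[of 0] that(3)
    show ?thesis by auto
  qed
  {
    case 0
    then show ?case using * by blast
  next
    case (Suc n)
    show ?case
      using Suc.IH[of "\<lambda>n. a (Suc n)" "\<lambda>n. b (Suc n)"] Suc.prems *[of a b] by blast
  }
qed

text \<open>The middle-thirds Cantor set scaled by 3/2: the factor comes from using digits 0, 1
  instead of 0, 2 and from starting at weight 1. Its central gap is (1/2, 1).\<close>

definition ternary_set :: "real set" where
  "ternary_set = ternary ` {a. \<forall>n. a n \<in> {0, 1}}"

text \<open>Self-similarity of the Cantor set: splitting on the leading digit gives two pieces, each
  mapped back into the set by an affine expansion of factor 3.\<close>

lemma ternary_set_cases: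
  assumes "t \<in> ternary_set"
  obtains "t \<in> {0..1/2}" "3 * t \<in> ternary_set" | "t \<in> {1..3/2}" "3 * (t - 1) \<in> ternary_set"
proof -
  obtain a where a: "\<And>n. a n \<in> {0, 1}" and t: "t = ternary a"
    using assms by (auto simp: ternary_set_def)
  have a': "\<And>n. a n \<in> {0..1}"
    using a by (metis atLeastAtMost_iff insertE order_refl singletonD zero_le_one)
  let ?r = "ternary (\<lambda>n. a (Suc n))"
  have "?r \<in> {0..3/2}" by (intro ternary_bounds a')
  moreover have "?r \<in> ternary_set" using a by (auto simp: ternary_set_def)
  ultimately show ?thesis
    using ternary_Suc[of a, OF a'] a[of 0] t that by auto
qed

text \<open>An interval inside the set cannot meet the gap (1/2, 1), so it lies in one of the two
  pieces, and the expanding map of that piece triples its length.\<close>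

lemma ternary_set_interval_expand:
  assumes "s \<le> t" "{s..t} \<subseteq> ternary_set"
  obtains s' where "{s'..s' + 3 * (t - s)} \<subseteq> ternary_set"
proof -
  have gap: "x \<notin> ternary_set" if "1/2 < x" "x < 1" for x
  proof
    assume "x \<in> ternary_set"
    then show False by (cases rule: ternary_set_cases) (use that in auto)
  qed
  have "s \<in> ternary_set" "t \<in> ternary_set" using assms by auto
  consider "t \<le> 1/2" | "1 \<le> s"
  proof -
    have False if "1/2 < t" "s < 1"
    proof -
      \<comment> \<open>The midpoint of the overlap of [s,t] with [1/2,1]. It lies strictly inside
        the gap, even if the overlap is a single point.\<close>
      have "(max s (1/2) + min t 1) / 2 \<in> {s..t}" using assms(1) that by (auto simp: field_simps)
      then show False
        using assms gap[of t] gap[of s] gap[of "(max s (1/2) + min t 1) / 2"] that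
          \<open>s \<in> ternary_set\<close> \<open>t \<in> ternary_set\<close>
        by (auto simp: subset_iff max_def min_def split: if_splits)
    qed
    then show ?thesis using that by force
  qed
  then show ?thesis
  proof cases
    case 1
    have "x \<in> ternary_set" if "x \<in> {3 * s..3 * s + 3 * (t - s)}" for x
    proof -
      have "x / 3 \<in> ternary_set" using assms(2) that by auto
      then show ?thesis by (cases rule: ternary_set_cases) (use that 1 in auto)
    qed
    then show ?thesis using that by blast
  next
    case 2
    have "x \<in> ternary_set" if "x \<in> {3 * (s - 1)..3 * (s - 1) + 3 * (t - s)}" for x
    proof -
      have "x / 3 + 1 \<in> ternary_set" using assms(2) that by auto
      then show ?thesis by (cases rule: ternary_set_cases) (use that 2 in auto)
    qed
    then show ?thesis using that by blast
  qed
qed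

text \<open>Repeated expansion turns an interval in the set into arbitrarily long ones, against the
  bound 3/2.\<close>

lemma interior_ternary_set: "interior ternary_set = {}"
proof (rule ccontr)
  assume "interior ternary_set \<noteq> {}"
  then obtain x e where xe: "e > 0" "cball x e \<subseteq> ternary_set"
    by (meson ex_in_conv mem_interior_cball)
  have "\<exists>s. {s..s + 3 ^ n * e} \<subseteq> ternary_set" for n
  proof (induction n)
    case 0
    then show ?case using xe by (intro exI[of _ x]) (auto simp: dist_real_def subset_iff)
  next
    case (Suc n)
    then obtain s where "{s..s + 3 ^ n * e} \<subseteq> ternary_set" by blast
    then obtain s' where "{s'..s' + 3 * (s + 3 ^ n * e - s)} \<subseteq> ternary_set"
      using xe ternary_set_interval_expand[of s "s + 3 ^ n * e"] by auto
    then show ?case by (auto simp: mult.assoc)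
  qed
  \<comment> \<open>This makes the expanded interval longer than 2, hence longer than 3/2.\<close>
  moreover obtain n where "2 / e < 3 ^ n" using real_arch_pow[of 3 "2 / e"] by auto
  ultimately obtain s where "{s..s + 3 ^ n * e} \<subseteq> ternary_set" by blast
  moreover have "0 \<le> 3 ^ n * e" using xe by simp
  ultimately have "s \<in> ternary_set" "s + 3 ^ n * e \<in> ternary_set" by auto
  moreover have "0 \<le> t \<and> t \<le> 3/2" if "t \<in> ternary_set" for t
    using that by (cases rule: ternary_set_cases) auto
  ultimately have "0 \<le> s" "s + 3 ^ n * e \<le> 3/2" by blast+
  with \<open>2 / e < 3 ^ n\<close> xe show False by (simp add: field_simps)
qed

section \<open>Chains\<close>

text \<open>Chains have at least one jump, so \<open>x\<close> need not belong to its own reachable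
  set; belonging to it for every \<open>\<epsilon>\<close> is chain recurrence.\<close>

definition chain_reach :: "'a::metric_space set \<Rightarrow> ('a \<Rightarrow> 'a) \<Rightarrow> real \<Rightarrow> 'a \<Rightarrow> 'a set" where
  "chain_reach X f \<epsilon> x = {y. \<exists>n p. eps_chain X f \<epsilon> x y n p}"

lemma chain_recurrent_set_reach:
  "chain_recurrent_set X f = {x \<in> X. \<forall>\<epsilon>>0. x \<in> chain_reach X f \<epsilon> x}"
  by (auto simp: chain_recurrent_set_def chain_reach_def)

lemma chain_equiv_reach:
  "chain_equiv X f x y \<longleftrightarrow> (\<forall>\<epsilon>>0. y \<in> chain_reach X f \<epsilon> x \<and> x \<in> chain_reach X f \<epsilon> y)"
  by (auto simp: chain_equiv_def chain_reach_def)

lemma chain_reach_subset: "chain_reach X f \<epsilon> x \<subseteq> X"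
  by (auto simp: chain_reach_def eps_chain_def)

lemma chain_reach_single:
  assumes "x \<in> X" "y \<in> X" "dist (f x) y < \<epsilon>"
  shows "y \<in> chain_reach X f \<epsilon> x"
proof -
  have "eps_chain X f \<epsilon> x y 1 (\<lambda>i. if i = 0 then x else y)"
    using assms by (auto simp: eps_chain_def)
  then show ?thesis by (auto simp: chain_reach_def)
qed

lemma chain_reach_step:
  assumes "y \<in> chain_reach X f \<epsilon> x" "z \<in> X" "dist (f y) z < \<epsilon>"
  shows "z \<in> chain_reach X f \<epsilon> x"
proof -
  obtain n p where p: "eps_chain X f \<epsilon> x y n p"
    using assms by (auto simp: chain_reach_def)
  have "eps_chain X f \<epsilon> x z (Suc n) (p(Suc n := z))"
    using p assms by (auto simp: eps_chain_def less_Suc_eq le_Suc_eq)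
  then show ?thesis by (auto simp: chain_reach_def)
qed

text \<open>Replacing the endpoints changes only the first jump, through \<open>f x\<close>, and the
  last one, through \<open>y\<close>. For a chain of one jump both errors fall on that jump, hence
  the sum \<open>\<epsilon> + a + b\<close>.\<close>

lemma chain_reach_perturb:
  assumes "y \<in> chain_reach X f \<epsilon> x" "x' \<in> X" "y' \<in> X"
    and "dist (f x) (f x') \<le> a" "dist y y' \<le> b"
  shows "y' \<in> chain_reach X f (\<epsilon> + a + b) x'"
proof -
  obtain n p where p: "eps_chain X f \<epsilon> x y n p"
    using assms by (auto simp: chain_reach_def)
  have ab: "0 \<le> a" "0 \<le> b"
    using assms zero_le_dist order_trans by blast+
  let ?q = "p(0 := x', n := y')"
  have step: "dist (f (p i)) (p (Suc i)) < \<epsilon>" if "i < n" for i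
    using p that by (auto simp: eps_chain_def)
  have f: "dist (f (?q i)) (f (p i)) \<le> a" if "i < n" for i
    using p assms(4) ab that by (auto simp: eps_chain_def dist_commute)
  have q: "dist (p (Suc i)) (?q (Suc i)) \<le> b" for i
    using p assms(5) ab by (auto simp: eps_chain_def)
  have "dist (f (?q i)) (?q (Suc i)) < \<epsilon> + a + b" if "i < n" for i
    using step[OF that] f[OF that] q[of i]
      dist_triangle[of "f (?q i)" "?q (Suc i)" "f (p i)"]
      dist_triangle[of "f (p i)" "?q (Suc i)" "p (Suc i)"] by linarith
  then have "eps_chain X f (\<epsilon> + a + b) x' y' n ?q"
    using p assms(2,3) unfolding eps_chain_def by auto
  then show ?thesis by (auto simp: chain_reach_def)
qed

text \<open>The last jump is strictly shorter than \<open>\<epsilon>\<close>; its slack is the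
  radius by which the endpoint may move.\<close>

lemma openin_chain_reach:
  assumes "f \<in> X \<rightarrow> X"
  shows "openin (top_of_set X) (chain_reach X f \<epsilon> x)"
  unfolding openin_euclidean_subtopology_iff
proof (intro conjI ballI chain_reach_subset)
  fix y assume "y \<in> chain_reach X f \<epsilon> x"
  then obtain n p where p: "eps_chain X f \<epsilon> x y n p"
    by (auto simp: chain_reach_def)
  then obtain m where m: "n = Suc m" by (cases n) (auto simp: eps_chain_def)
  define e where "e = \<epsilon> - dist (f (p m)) y"
  have "z \<in> chain_reach X f \<epsilon> x" if "z \<in> X" "dist z y < e" for z
  proof -
    have "dist (f (p m)) z < \<epsilon>"
      using that dist_triangle[of "f (p m)" z y] by (simp add: e_def dist_commute)
    then have "eps_chain X f \<epsilon> x z n (p(n := z))"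
      using p that m by (auto simp: eps_chain_def)
    then show ?thesis by (auto simp: chain_reach_def)
  qed
  moreover have "e > 0" using p m by (auto simp: e_def eps_chain_def)
  ultimately show "\<exists>e>0. \<forall>z\<in>X. dist z y < e \<longrightarrow> z \<in> chain_reach X f \<epsilon> x" by blast
qed

text \<open>A limit point \<open>z\<close> has a reachable \<open>y\<close> so near that
  \<open>f y\<close> is within \<open>\<epsilon>\<close> of \<open>f z\<close>; one more jump, from
  \<open>y\<close> to \<open>f z\<close>, extends the chain.\<close>

lemma image_closure_chain_reach:
  assumes "closed X" "continuous_on X f" "f \<in> X \<rightarrow> X" "\<epsilon> > 0"
  shows "f ` closure (chain_reach X f \<epsilon> x) \<subseteq> chain_reach X f \<epsilon> x"
proof
  fix w assume "w \<in> f ` closure (chain_reach X f \<epsilon> x)"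
  then obtain z where z: "z \<in> closure (chain_reach X f \<epsilon> x)" "w = f z" by blast
  have "z \<in> X"
    using z(1) closure_minimal[OF chain_reach_subset assms(1)] by blast
  then obtain d where d: "d > 0" "\<And>y. y \<in> X \<Longrightarrow> dist y z < d \<Longrightarrow> dist (f y) (f z) < \<epsilon>"
    using assms(2,4) \<open>z \<in> X\<close> unfolding continuous_on_iff by metis
  obtain y where y: "y \<in> chain_reach X f \<epsilon> x" "dist y z < d"
    using z(1) d(1) by (auto simp: closure_approachable)
  then have "dist (f y) w < \<epsilon>"
    using d(2) chain_reach_subset z(2) by blast
  moreover have "w \<in> X"
    using z(2) \<open>z \<in> X\<close> assms(3) by auto
  ultimately show "w \<in> chain_reach X f \<epsilon> x"
    using chain_reach_step y(1) by blast
qed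

text \<open>Both ends of a loop at a nearby recurrent point are moved to \<open>x\<close>. The
  original jumps, the error at \<open>f x\<close> and the error at \<open>x\<close> take a third of
  \<open>\<epsilon>\<close> each.\<close>

lemma closed_chain_recurrent_set:
  assumes "closed X" "continuous_on X f"
  shows "closed (chain_recurrent_set X f)"
proof -
  have "x \<in> chain_recurrent_set X f" if x: "x \<in> closure (chain_recurrent_set X f)" for x
  proof -
    have "x \<in> X"
      using x assms(1) closure_minimal[of "chain_recurrent_set X f" X]
      by (auto simp: chain_recurrent_set_def)
    moreover have "x \<in> chain_reach X f \<epsilon> x" if "\<epsilon> > 0" for \<epsilon>
    proof -
      obtain d where d: "d > 0" "\<And>y. y \<in> X \<Longrightarrow> dist y x < d \<Longrightarrow> dist (f y) (f x) < \<epsilon>/3"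
        using assms(2) \<open>x \<in> X\<close> \<open>\<epsilon> > 0\<close> unfolding continuous_on_iff
        by (metis divide_pos_pos zero_less_numeral)
      obtain y where y: "y \<in> chain_recurrent_set X f" "dist y x < min d (\<epsilon>/3)"
        using x d(1) \<open>\<epsilon> > 0\<close> unfolding closure_approachable
        by (metis divide_pos_pos min_less_iff_conj zero_less_numeral)
      then have "y \<in> X" "y \<in> chain_reach X f (\<epsilon>/3) y"
        using \<open>\<epsilon> > 0\<close> by (auto simp: chain_recurrent_set_reach)
      then show ?thesis
        using chain_reach_perturb[of y X f "\<epsilon>/3" y x x "\<epsilon>/3" "\<epsilon>/3"] d(2)[of y] y(2) \<open>x \<in> X\<close>
        by auto
    qed
    ultimately show ?thesis by (auto simp: chain_recurrent_set_reach)
  qed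
  then show ?thesis by (metis closure_subset closed_closure subsetI subset_antisym)
qed

section \<open>Trapping regions\<close>

text \<open>The compact set \<open>f\<close> closure
  U\<open>has a neighbourhood of some radius\<close>e\<open>that stays, within\<close>X\<open>, inside\<close>U\<open>. Chains with jumps below\<close>e\<open>that start in\<close>closure
  U\<open>therefore never leave it, and their last jump starts in\<close>f \<open>closure U\<close>.
  So \<open>y\<close> is a limit of points of this closed set.\<close>

lemma chain_reach_trapped:
  assumes "compact X" "continuous_on X f" "openin (top_of_set X) U" "f ` closure U \<subseteq> U"
    and "x \<in> closure U" "\<And>\<epsilon>. \<epsilon> > 0 \<Longrightarrow> y \<in> chain_reach X f \<epsilon> x"
  shows "y \<in> f ` closure U"
proof -
  have UX: "U \<subseteq> X" using assms(3) openin_imp_subset by blast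
  then have cU: "closure U \<subseteq> X" by (simp add: assms(1) closure_minimal compact_imp_closed)
  then have "compact (closure U)"
    by (metis assms(1) closed_closure compact_Int_closed inf.absorb_iff2)
  then have K: "compact (f ` closure U)"
    using assms(2) cU compact_continuous_image continuous_on_subset by blast
  obtain T where T: "open T" "U = X \<inter> T" using assms(3) by (auto simp: openin_open)
  obtain e where e: "e > 0" "(\<Union>k\<in>f ` closure U. ball k e) \<subseteq> T"
    using compact_subset_open_imp_ball_epsilon_subset[OF K T(1)] assms(4) T(2) by blast
  have near: "\<exists>k\<in>f ` closure U. dist k y < \<epsilon>" if \<epsilon>: "0 < \<epsilon>" "\<epsilon> \<le> e" for \<epsilon>
  proof -
    obtain n p where p: "eps_chain X f \<epsilon> x y n p"
      using assms(6)[OF \<epsilon>(1)] by (auto simp: chain_reach_def)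
    have *: "p i \<in> closure U" if "i \<le> n" for i
      using that
    proof (induction i)
      case 0
      then show ?case using p assms(5) by (simp add: eps_chain_def)
    next
      case (Suc i)
      then have "f (p i) \<in> f ` closure U" "dist (f (p i)) (p (Suc i)) < e" "p (Suc i) \<in> X"
        using p \<epsilon> by (auto simp: eps_chain_def intro: less_le_trans)
      then have "p (Suc i) \<in> T" using e(2) mem_ball by blast
      then have "p (Suc i) \<in> U" using \<open>p (Suc i) \<in> X\<close> T(2) by blast
      then show ?case using closure_subset by blast
    qed
    obtain m where "n = Suc m" using p by (cases n) (auto simp: eps_chain_def)
    then have "dist (f (p m)) y < \<epsilon>" "p m \<in> closure U" using p * by (auto simp: eps_chain_def)
    then show ?thesis by blast
  qed
  have "y \<in> closure (f ` closure U)"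
    unfolding closure_approachable
  proof (intro allI impI)
    fix r :: real assume "r > 0"
    \<comment> \<open>The bound \<open>e\<close> keeps the chain trapped; the bound \<open>r\<close>
      gives the required accuracy.\<close>
    then show "\<exists>k\<in>f ` closure U. dist k y < r"
      using near[of "min r e"] e(1) by auto
  qed
  then show ?thesis using K compact_imp_closed closure_closed by blast
qed

definition trapping_function :: "'a::metric_space set \<Rightarrow> ('a \<Rightarrow> 'a) \<Rightarrow> 'a set \<Rightarrow> ('a \<Rightarrow> real) \<Rightarrow> bool" where
  "trapping_function X f U u \<longleftrightarrow>
     continuous_on X u \<and> u ` X \<subseteq> {0..1} \<and>
     (\<forall>x \<in> f ` closure U. u x = 0) \<and> (\<forall>x \<in> X - U. u x = 1) \<and> (\<forall>x \<in> U. u x < 1)"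

text \<open>The quotient of distances to two disjoint closed sets. The cases where one of them is
  empty are separate because \<open>infdist\<close> to the empty set is 0 by convention, so it would
  not detect membership.\<close>

lemma trapping_function_exists:
  assumes "compact X" "continuous_on X f" "openin (top_of_set X) U" "f ` closure U \<subseteq> U"
  shows "\<exists>u. trapping_function X f U u"
proof (cases "U = {} \<or> U = X")
  case True
  then show ?thesis
  proof
    assume "U = {}"
    then show ?thesis
      by (intro exI[of _ "\<lambda>_. 1"]) (auto simp: trapping_function_def)
  next
    assume "U = X"
    then show ?thesis
      by (intro exI[of _ "\<lambda>_. 0"]) (auto simp: trapping_function_def)
  qed
next
  case False
  define A where "A = f ` closure U"
  define B where "B = X - U"
  have UX: "U \<subseteq> X" using assms(3) openin_imp_subset by blast
  then have cU: "closure U \<subseteq> X" by (simp add: assms(1) closure_minimal compact_imp_closed)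
  then have "compact (closure U)"
    by (metis assms(1) closed_closure compact_Int_closed inf.absorb_iff2)
  then have "closed A" unfolding A_def
    using assms(2) cU compact_continuous_image continuous_on_subset compact_imp_closed by metis
  have "closedin (top_of_set X) B"
    using assms(3) by (simp add: B_def closedin_diff)
  then have "closed B"
    using assms(1) closedin_closed_trans compact_imp_closed by blast
  have ne: "A \<noteq> {}" "B \<noteq> {}" using False UX by (auto simp: A_def B_def)
  have disj: "x \<notin> A" if "x \<in> B" for x using that assms(4) by (auto simp: A_def B_def)
  define u where "u x = infdist x A / (infdist x A + infdist x B)" for x
  have A0: "infdist x A = 0 \<longleftrightarrow> x \<in> A" and B0: "infdist x B = 0 \<longleftrightarrow> x \<in> B" for x
    using ne \<open>closed A\<close> \<open>closed B\<close> in_closed_iff_infdist_zero by blast+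
  have pos: "infdist x A + infdist x B > 0" for x
    using A0[of x] B0[of x] disj[of x] infdist_nonneg[of x A] infdist_nonneg[of x B] by linarith
  have "continuous_on X u"
    unfolding u_def by (intro continuous_intros) (use pos in \<open>auto simp: less_imp_neq[symmetric]\<close>)
  moreover have "u x \<in> {0..1}" for x
    using pos[of x] infdist_nonneg[of x A] infdist_nonneg[of x B] by (simp add: u_def)
  moreover have "u x = 0" if "x \<in> A" for x using A0[of x] that by (simp add: u_def)
  moreover have "u x = 1" if "x \<in> B" for x using B0[of x] pos[of x] that by (simp add: u_def)
  moreover have "u x < 1" if "x \<in> U" for x
    using B0[of x] pos[of x] infdist_nonneg[of x B] that by (auto simp: u_def B_def less_le)
  ultimately show ?thesis
    unfolding trapping_function_def A_def B_def by (intro exI[of _ u]) auto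
qed

text \<open>On \<open>closure U\<close> the new value is the minimum 0; elsewhere the old value is
  the maximum 1.\<close>

lemma trapping_function_antimono:
  assumes "trapping_function X f U u" "f \<in> X \<rightarrow> X" "x \<in> X"
  shows "u (f x) \<le> u x"
proof (cases "x \<in> closure U")
  case True
  then show ?thesis using assms by (auto simp: trapping_function_def image_subset_iff)
next
  case False
  then have "x \<in> X - U" using assms(3) closure_subset by blast
  moreover have "f x \<in> X" using assms by auto
  ultimately show ?thesis using assms(1) by (auto simp: trapping_function_def image_subset_iff)
qed

text \<open>With \<open>y = x\<close> this shows that a chain recurrent point of \<open>U\<close>
  has value 0, so intermediate values do not occur on the chain recurrent set.\<close>

lemma trapping_function_chain:
  assumes "compact X" "continuous_on X f" "openin (top_of_set X) U" "f ` closure U \<subseteq> U"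
    and u: "trapping_function X f U u"
    and "x \<in> U" "\<And>\<epsilon>. \<epsilon> > 0 \<Longrightarrow> y \<in> chain_reach X f \<epsilon> x"
  shows "u y = 0"
proof -
  have "x \<in> closure U" using \<open>x \<in> U\<close> closure_subset by blast
  then have "y \<in> f ` closure U" by (rule chain_reach_trapped[OF assms(1-4) _ assms(7)])
  then show ?thesis using u unfolding trapping_function_def by blast
qed

text \<open>The union of finite nets of mesh \<open>1 / Suc n\<close> is dense.\<close>

lemma compact_countable_dense:
  fixes X :: "'a::metric_space set"
  assumes "compact X"
  obtains D where "countable D" "D \<subseteq> X" "X \<subseteq> closure D"
proof -
  have "\<exists>K. finite K \<and> K \<subseteq> X \<and> X \<subseteq> (\<Union>x\<in>K. ball x (1 / Suc n))" for n
    using seq_compact_imp_totally_bounded[OF compact_imp_seq_compact[OF assms]] by auto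
  then obtain K where K: "\<And>n. finite (K n)" "\<And>n. K n \<subseteq> X"
      "\<And>n. X \<subseteq> (\<Union>x\<in>K n. ball x (1 / Suc n))"
    by metis
  have "x \<in> closure (\<Union>n. K n)" if "x \<in> X" for x
    unfolding closure_approachable
  proof (intro allI impI)
    fix e :: real assume "e > 0"
    then obtain n where "1 / Suc n < e" using nat_approx_posE by blast
    moreover obtain y where "y \<in> K n" "dist y x < 1 / Suc n" using K(3)[of n] \<open>x \<in> X\<close> by auto
    ultimately show "\<exists>y\<in>\<Union>n. K n. dist y x < e" by (meson UN_I UNIV_I order_less_trans)
  qed
  then show ?thesis
    using that[of "\<Union>n. K n"] K(1,2) by (auto simp: countable_finite)
qed

section \<open>Complete Lyapunov functions\<close>

text \<open>Separates the summation from the dynamics. Continuity is the Weierstrass M-test, descent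
  is termwise, unique digits turn equal sums into equality of all \<open>u i\<close>, and the
  critical values form a compact subset of the Cantor set.\<close>

lemma complete_lyapunov_function_ternary:
  fixes u :: "nat \<Rightarrow> 'a::metric_space \<Rightarrow> real"
  assumes "compact X" "continuous_on X f" "f \<in> X \<rightarrow> X"
    and cont: "\<And>i. continuous_on X (u i)"
    and range: "\<And>i x. x \<in> X \<Longrightarrow> u i x \<in> {0..1}"
    and le: "\<And>i x. x \<in> X \<Longrightarrow> u i (f x) \<le> u i x"
    and less: "\<And>x. x \<in> X - chain_recurrent_set X f \<Longrightarrow> \<exists>i. u i (f x) < u i x"
    and digits: "\<And>i x. x \<in> chain_recurrent_set X f \<Longrightarrow> u i x \<in> {0, 1}"
    and sep: "\<And>x y. x \<in> chain_recurrent_set X f \<Longrightarrow> y \<in> chain_recurrent_set X f \<Longrightarrow>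
                (\<forall>i. u i x = u i y) \<longleftrightarrow> chain_equiv X f x y"
  shows "complete_lyapunov_function X f (\<lambda>x. ternary (\<lambda>i. u i x))"
    (is "complete_lyapunov_function X f ?g")
proof -
  let ?R = "chain_recurrent_set X f"
  have RX: "?R \<subseteq> X" by (auto simp: chain_recurrent_set_def)
  have g_cont: "continuous_on X ?g"
  proof -
    have "uniform_limit X (\<lambda>n x. \<Sum>i<n. u i x / 3 ^ i) ?g sequentially"
      unfolding ternary_def
    proof (rule Weierstrass_m_test[OF _ summable_third_powers])
      show "norm (u n x / 3 ^ n) \<le> 1 / 3 ^ n" if "x \<in> X" for n x
        using range[OF that, of n] by (simp add: divide_right_mono)
    qed
    moreover have "\<forall>\<^sub>F n in sequentially. continuous_on X (\<lambda>x. \<Sum>i<n. u i x / 3 ^ i)"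
      by (intro always_eventually allI continuous_intros cont) auto
    ultimately show ?thesis by (intro uniform_limit_theorem[where F = sequentially]) auto
  qed
  have g_less: "?g (f x) < ?g x" if x: "x \<in> X - ?R" for x
  proof -
    obtain i where i: "u i (f x) < u i x" using less[OF x] by blast
    have fx: "x \<in> X" "f x \<in> X" using x assms(3) by auto
    have sm: "summable (\<lambda>i. u i x / 3 ^ i)" "summable (\<lambda>i. u i (f x) / 3 ^ i)"
      by (intro summable_ternary range fx)+
    \<comment> \<open>All terms are nonnegative and the one at the chosen \<open>i\<close> is
      positive.\<close>
    have "0 < (\<Sum>i. u i x / 3 ^ i - u i (f x) / 3 ^ i)"
      using i le[OF fx(1)]
      by (intro suminf_pos2[where i = i] summable_diff sm)
        (auto simp: divide_right_mono divide_strict_right_mono)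
    then show ?thesis
      by (simp add: ternary_def suminf_diff[OF sm, symmetric])
  qed
  have g_eq: "?g x = ?g y \<longleftrightarrow> chain_equiv X f x y" if "x \<in> ?R" "y \<in> ?R" for x y
  proof -
    have "(\<forall>i. u i x = u i y)" if "?g x = ?g y"
      using ternary_inj[OF digits[OF \<open>x \<in> ?R\<close>] digits[OF \<open>y \<in> ?R\<close>] that] by blast
    then show ?thesis using sep[OF that] by (metis (no_types, lifting) ext)
  qed
  have "compact ?R"
    using assms(1,2) RX closed_chain_recurrent_set compact_imp_closed
    by (metis compact_Int_closed inf.absorb_iff2)
  then have g_compact: "compact (?g ` ?R)"
    using RX g_cont compact_continuous_image continuous_on_subset by blast
  have "?g ` ?R \<subseteq> ternary_set"
    using digits by (auto simp: ternary_set_def)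
  then have "interior (?g ` ?R) = {}"
    using interior_mono interior_ternary_set by blast
  then have "nowhere_dense (?g ` ?R)"
    using g_compact by (simp add: nowhere_dense_def compact_imp_closed)
  then show ?thesis
    unfolding complete_lyapunov_function_def using g_cont g_less g_eq g_compact by blast
qed

section \<open>A countable family of trapping regions and the complete Lyapunov function\<close>

theorem theorem2p8:
  fixes X :: "'a::metric_space set" and f :: "'a \<Rightarrow> 'a"
  assumes "compact X"
    and "\<exists>finv. homeomorphism X X f finv"
  shows "\<exists>g :: 'a \<Rightarrow> real. complete_lyapunov_function X f g"
proof (cases "X = {}")
  case True
  then show ?thesis
    by (auto simp: complete_lyapunov_function_def chain_recurrent_set_def nowhere_dense_def)
next
  case False
  let ?R = "chain_recurrent_set X f"
  have cf: "continuous_on X f" and fX: "f \<in> X \<rightarrow> X"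
    using assms(2) by (auto simp: homeomorphism_def)
  have "closed X" using assms(1) compact_imp_closed by blast
  obtain D where D: "countable D" "D \<subseteq> X" "X \<subseteq> closure D"
    using compact_countable_dense[OF assms(1)] by blast
  \<comment> \<open>\<open>from_nat_into\<close> enumerates exactly \<open>E\<close> only if
    \<open>E\<close> is countable and nonempty, which is why empty \<open>X\<close> was treated
    apart.\<close>
  define E where "E = D \<times> (range (\<lambda>n. 1 / Suc n :: real))"
  have "D \<noteq> {}" using D False by auto
  then have E: "countable E" "E \<noteq> {}" using D by (auto simp: E_def)
  define U where "U i = (case from_nat_into E i of (q, \<epsilon>) \<Rightarrow> chain_reach X f \<epsilon> q)" for i
  have U_open: "openin (top_of_set X) (U i)" for i
    by (simp add: U_def openin_chain_reach[OF fX] split: prod.split)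
  have U_trap: "f ` closure (U i) \<subseteq> U i" for i
  proof -
    obtain q n where "from_nat_into E i = (q, 1 / real (Suc n))"
      using from_nat_into[OF E(2), of i] by (auto simp: E_def)
    then show ?thesis
      using image_closure_chain_reach[OF \<open>closed X\<close> cf fX] by (simp add: U_def)
  qed
  obtain u where u: "\<And>i. trapping_function X f (U i) (u i)"
    using trapping_function_exists[OF assms(1) cf U_open U_trap] by metis
  \<comment> \<open>The countable family approximates the reachable sets of every \<open>x\<close>.
    A dense point \<open>q\<close> with \<open>f q\<close> within \<open>r/2\<close> of
    \<open>f x\<close> is used with tolerance \<open>r < \<epsilon>/2\<close>: passing from
    \<open>q\<close> to \<open>x\<close> costs less than \<open>\<epsilon> - r\<close>, and chains
    from \<open>x\<close> with jumps below \<open>r/2\<close> become chains from \<open>q\<close>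
    with jumps below \<open>r\<close>.\<close>
  have find: "\<exists>i. \<exists>\<delta>>0. U i \<subseteq> chain_reach X f \<epsilon> x \<and> chain_reach X f \<delta> x \<subseteq> U i \<and> f x \<in> U i"
    if x: "x \<in> X" and "\<epsilon> > 0" for x \<epsilon>
  proof -
    obtain n where n: "1 / Suc n < \<epsilon>/2" using nat_approx_posE[of "\<epsilon>/2"] \<open>\<epsilon> > 0\<close> by auto
    define r where "r = 1 / real (Suc n)"
    have r: "0 < r" "r < \<epsilon>/2" using n by (auto simp: r_def)
    obtain d where d: "d > 0" "\<And>y. y \<in> X \<Longrightarrow> dist y x < d \<Longrightarrow> dist (f y) (f x) < r/2"
      using cf x r(1) unfolding continuous_on_iff by (metis half_gt_zero)
    obtain q where q: "q \<in> D" "dist q x < d"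
      using D(3) x d(1) by (meson closure_approachable subsetD)
    have "q \<in> X" using q D by auto
    have fq: "dist (f q) (f x) < r/2" using d(2) q \<open>q \<in> X\<close> by blast
    have "(q, r) \<in> E" using q by (auto simp: E_def r_def)
    then obtain i where i: "from_nat_into E i = (q, r)"
      using from_nat_into_surj[OF E(1)] by blast
    then have Ui: "U i = chain_reach X f r q" by (simp add: U_def)
    have "f x \<in> U i"
      using chain_reach_single[of q X "f x" f r] \<open>q \<in> X\<close> x fX fq r(1) Ui by auto
    moreover have "U i \<subseteq> chain_reach X f \<epsilon> x"
    proof
      fix y assume y: "y \<in> U i"
      then have "y \<in> X" using Ui chain_reach_subset by blast
      then show "y \<in> chain_reach X f \<epsilon> x"
        using chain_reach_perturb[of y X f r q x y "\<epsilon> - r" 0] y Ui x fq r by auto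
    qed
    moreover have "chain_reach X f (r/2) x \<subseteq> U i"
    proof
      fix y assume y: "y \<in> chain_reach X f (r/2) x"
      then have "y \<in> X" using chain_reach_subset by blast
      then show "y \<in> U i"
        using chain_reach_perturb[of y X f "r/2" x q y "r/2" 0] y Ui \<open>q \<in> X\<close> fq r
        by (auto simp: dist_commute)
    qed
    ultimately show ?thesis using r(1) half_gt_zero by blast
  qed
  have R_chain: "u i y = 0" if "x \<in> U i" "\<And>\<epsilon>. \<epsilon> > 0 \<Longrightarrow> y \<in> chain_reach X f \<epsilon> x" for i x y
    using trapping_function_chain[OF assms(1) cf U_open U_trap u that] .
  have R1: "u i x = 1" if "x \<in> X" "x \<notin> U i" for i x
    using u[of i] that by (auto simp: trapping_function_def)
  have digits: "u i x \<in> {0, 1}" if "x \<in> ?R" for i x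
    using that R_chain[of x i x] R1[of x i] by (auto simp: chain_recurrent_set_reach)
  \<comment> \<open>Every digit is nonincreasing along the chain order, so chain equivalent points
    have the same digits.\<close>
  have digit_le: "u i y \<le> u i x" 
    if "x \<in> ?R" "y \<in> ?R" "\<And>\<epsilon>. \<epsilon> > 0 \<Longrightarrow> y \<in> chain_reach X f \<epsilon> x" for i x y
  proof (cases "x \<in> U i")
    case True
    then show ?thesis using R_chain[OF True that(3)] digits[OF that(1), of i] by auto
  next
    case False
    then show ?thesis
      using R1[of x i] that(1) digits[OF that(2), of i] by (auto simp: chain_recurrent_set_def)
  qed
  have sep: "\<exists>i. u i x \<noteq> u i y"
    if R: "x \<in> ?R" "y \<in> ?R" and \<epsilon>: "\<epsilon> > 0" "y \<notin> chain_reach X f \<epsilon> x" for x y \<epsilon>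
  proof -
    have xy: "x \<in> X" "y \<in> X" and x: "\<And>\<epsilon>. \<epsilon> > 0 \<Longrightarrow> x \<in> chain_reach X f \<epsilon> x"
      using R by (auto simp: chain_recurrent_set_reach)
    \<comment> \<open>The outer inclusion of \<open>find\<close> excludes \<open>y\<close>; the
      inner one contains \<open>x\<close>, because \<open>x\<close> is reachable from itself with
      every tolerance.\<close>
    obtain i where "y \<notin> U i" "x \<in> U i"
      using find[OF xy(1) \<epsilon>(1)] x \<epsilon>(2) by blast
    then have "u i y = 1" "u i x = 0" using R1 R_chain[OF _ x] xy by auto
    then show ?thesis by (intro exI[of _ i]) simp
  qed
  have "complete_lyapunov_function X f (\<lambda>x. ternary (\<lambda>i. u i x))"
  proof (rule complete_lyapunov_function_ternary[OF assms(1) cf fX])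
    show "continuous_on X (u i)" for i using u[of i] by (simp add: trapping_function_def)
    show "u i x \<in> {0..1}" if "x \<in> X" for i x
      using u[of i] that by (auto simp: trapping_function_def)
    show "u i (f x) \<le> u i x" if "x \<in> X" for i x
      using trapping_function_antimono[OF u fX that] .
    show "\<exists>i. u i (f x) < u i x" if x: "x \<in> X - ?R" for x
    proof -
      obtain \<epsilon> where \<epsilon>: "\<epsilon> > 0" "x \<notin> chain_reach X f \<epsilon> x"
        using x by (auto simp: chain_recurrent_set_reach)
      \<comment> \<open>A point that does not return to itself at tolerance
        \<open>\<epsilon>\<close> lies outside \<open>U i\<close> while its image is inside, so the
        value drops from 1 to below 1.\<close>
      then obtain i where "x \<notin> U i" "f x \<in> U i" using find[of x \<epsilon>] x by blast
      then have "u i (f x) < u i x" using R1[of x i] x u[of i] by (auto simp: trapping_function_def)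
      then show ?thesis ..
    qed
    show "u i x \<in> {0, 1}" if "x \<in> ?R" for i x using digits[OF that] .
    show "(\<forall>i. u i x = u i y) \<longleftrightarrow> chain_equiv X f x y" if "x \<in> ?R" "y \<in> ?R" for x y
      using sep[OF that] sep[OF that(2,1)] digit_le[OF that] digit_le[OF that(2,1)]
      unfolding chain_equiv_reach by (metis order_antisym)
  qed
  then show ?thesis by blast
qed

end
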